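(* Let $\mathbb{F}$ be a field (not necessarily finite). Let $k \geq 2$ and $n \geq 2k$ be integers. Then $J_{0,n}$ is a sum of two $k$th powers in $M_n(\mathbb{F})$, i.e. there exist $A, B \in M_n(\mathbb{F})$ with $J_{0,n} = A^k + B^k$.
   Context: $M_n(\mathbb{F})$ is the ring of $n \times n$ matrices over $\mathbb{F}$. $J_{0,n} \in M_n(\mathbb{F})$ is the nilpotent Jordan block of size $n$: the matrix whose super-diagonal entries (positions $(i,i+1)$, $1 \leq i \leq n-1$) are all $1$ and whose other entries are all $0$. *)

theory Defs
  imports "Jordan_Normal_Form.Jordan_Normal_Form"
begin

end

theory Submission
  imports Defs
begin

text \<open>
  Delete the \<open>k - 1\<close> superdiagonal ones of \<open>J\<^bsub>0,n\<^esub>\<close> that link \<open>k\<close> consecutive diagonal blocks of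
  sizes \<open>\<lfloor>n/k\<rfloor>\<close> or \<open>\<lceil>n/k\<rceil>\<close>, the larger ones first. What is left is a direct sum of \<open>k\<close> nilpotent
  Jordan blocks of nearly equal sizes, which is similar to the \<open>k\<close>th power of \<open>J\<^bsub>0,n\<^esub>\<close>.
  As \<open>n \<ge> 2k\<close>, all blocks have size at least \<open>2\<close>, so the deleted entries form a matrix of square
  zero and rank \<open>k - 1\<close> with kernel large enough to be similar to \<open>J\<^bsub>0,2k-1\<^esub>\<^sup>k \<oplus> 0\<close>. Both
  similarities are given by injections of index sets.
\<close>

section \<open>Partial shift matrices\<close>

text \<open>For \<open>g\<close> injective on \<open>{..<L}\<close> with values below
  \<open>n\<close>, this is the \<open>m\<close>-th power of the Jordan block of size
  \<open>L\<close>, placed on the indices \<open>g 0, ..., g (L - 1)\<close> and extended by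
  zero.\<close>

definition chain_mat :: "nat \<Rightarrow> nat \<Rightarrow> (nat \<Rightarrow> nat) \<Rightarrow> nat \<Rightarrow> 'a :: semiring_1 mat" where
  "chain_mat n L g m =
    mat n n (\<lambda>(i, j). if \<exists>x. x + m < L \<and> i = g x \<and> j = g (x + m) then 1 else 0)"

lemma chain_mat_carrier [simp]: "chain_mat n L g m \<in> carrier_mat n n"
  by (simp add: chain_mat_def)

text \<open>A step of \<open>m\<close> followed by a step of \<open>l\<close> is a step of
  \<open>m + l\<close>. Injectivity makes the intermediate index unique, so no sum has two nonzero
  terms.\<close>

lemma chain_mat_mult:
  assumes inj: "inj_on g {..<L}" and sub: "g ` {..<L} \<subseteq> {..<n}"
  shows "chain_mat n L g m * chain_mat n L g l = (chain_mat n L g (m + l) :: 'a :: semiring_1 mat)"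
proof (rule eq_matI)
  fix i j
  assume "i < dim_row (chain_mat n L g (m + l) :: 'a mat)"
    and "j < dim_col (chain_mat n L g (m + l) :: 'a mat)"
  then have ij: "i < n" "j < n" by (simp_all add: chain_mat_def)
  let ?P = "\<lambda>m i j. \<exists>x. x + m < L \<and> i = g x \<and> j = g (x + m)"
  have "(chain_mat n L g m * chain_mat n L g l :: 'a mat) $$ (i, j)
      = (\<Sum>t<n. (if ?P m i t then 1 else 0) * (if ?P l t j then 1 else 0))"
    using ij by (simp add: chain_mat_def scalar_prod_def atLeast0LessThan)
  also have "\<dots> = (\<Sum>t<n. if ?P m i t \<and> ?P l t j then 1 else 0)"
    by (rule sum.cong) auto
  also have "\<dots> = (if ?P (m + l) i j then 1 else 0)"
  proof (cases "?P (m + l) i j")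
    case True
    then obtain x where x: "x + (m + l) < L" "i = g x" "j = g (x + (m + l))" by blast
    have "(?P m i t \<and> ?P l t j) = (t = g (x + m))" for t
    proof
      assume "?P m i t \<and> ?P l t j"
      then obtain y where "y + m < L" "i = g y" "t = g (y + m)" by blast
      with x show "t = g (x + m)" using inj_onD[OF inj, of x y] by simp
    next
      assume "t = g (x + m)"
      with x show "?P m i t \<and> ?P l t j"
        by (intro conjI exI[of _ x] exI[of _ "x + m"]) (simp_all add: add.assoc)
    qed
    moreover have "g (x + m) < n"
    proof -
      have "x + m \<in> {..<L}" using x by simp
      then show ?thesis using sub by blast
    qed
    ultimately show ?thesis using True by simp
  next
    case False
    have "\<not> (?P m i t \<and> ?P l t j)" for t
    proof
      assume "?P m i t \<and> ?P l t j"
      then obtain x y where xy: "x + m < L" "i = g x" "t = g (x + m)"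
        "y + l < L" "t = g y" "j = g (y + l)" by blast
      then have "y = x + m" using inj_onD[OF inj, of "x + m" y] by simp
      with xy False show False by (auto simp: add.assoc)
    qed
    with False show ?thesis by (simp only: if_False sum.neutral_const)
  qed
  finally show "(chain_mat n L g m * chain_mat n L g l :: 'a mat) $$ (i, j)
      = chain_mat n L g (m + l) $$ (i, j)"
    using ij by (simp add: chain_mat_def)
qed (simp_all add: chain_mat_def)

text \<open>The induction starts at 1 because \<open>chain_mat n L g 0\<close> is only the
  projection onto the indices hit by \<open>g\<close>, in general not the identity.\<close>

lemma chain_mat_pow:
  assumes "inj_on g {..<L}" and "g ` {..<L} \<subseteq> {..<n}" and "m \<ge> 1"
  shows "chain_mat n L g 1 ^\<^sub>m m = (chain_mat n L g m :: 'a :: semiring_1 mat)"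
  using assms(3)
proof (induction m rule: nat_induct_at_least)
  case base
  have "dim_row (chain_mat n L g 1 :: 'a mat) = n" by (simp add: chain_mat_def)
  then show ?case using left_mult_one_mat[OF chain_mat_carrier] by simp
next
  case (Suc m)
  then show ?case using chain_mat_mult[OF assms(1,2), of m 1] by simp
qed

section \<open>Nearly equal consecutive blocks and two enumerations of indices\<close>

text \<open>The \<open>min\<close> term counts the blocks of size \<open>n div k + 1\<close> among
  the first \<open>c\<close>; all others have size \<open>n div k\<close>.\<close>

definition block_start :: "nat \<Rightarrow> nat \<Rightarrow> nat \<Rightarrow> nat" where
  "block_start n k c = c * (n div k) + min c (n mod k)"

lemma block_start_0 [simp]: "block_start n k 0 = 0"
  by (simp add: block_start_def)

lemma block_start_last: "k > 0 \<Longrightarrow> block_start n k k = n"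
  by (simp add: block_start_def)

lemma block_start_gap:
  assumes "k > 0" "n \<ge> 2 * k"
  shows "block_start n k c + 2 \<le> block_start n k (Suc c)"
proof -
  have "2 \<le> n div k" using assms by (simp add: less_eq_div_iff_mult_less_eq)
  then show ?thesis by (simp add: block_start_def)
qed

lemma block_start_mono: "c \<le> d \<Longrightarrow> block_start n k c \<le> block_start n k d"
  by (auto simp: block_start_def intro!: add_mono)

text \<open>Numbering the elements row by row across the blocks gives offset \<open>p\<close> of
  block \<open>c\<close> the number \<open>p * k + c\<close>. The numbers used are exactly those
  below \<open>n\<close> because the larger blocks come first.\<close>

lemma block_start_inside_iff:
  assumes "c < k"
  shows "block_start n k c + p < block_start n k (Suc c) \<longleftrightarrow> p * k + c < n"
proof -
  define q r where qr: "q = n div k" "r = n mod k"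
  have n: "n = q * k + r" by (simp add: qr)
  have r: "r < k" using assms by (simp add: qr)
  have "p * k + c < q * k + r \<longleftrightarrow> p < q \<or> p = q \<and> c < r"
  proof (cases p q rule: linorder_cases)
    case less
    then have "Suc p * k \<le> q * k" by (intro mult_le_mono1) simp
    with less assms show ?thesis by simp
  next
    case greater
    then have "Suc q * k \<le> p * k" by (intro mult_le_mono1) simp
    with greater r show ?thesis by simp
  qed simp
  moreover have "block_start n k c + p < block_start n k (Suc c) \<longleftrightarrow> p < q \<or> p = q \<and> c < r"
    by (auto simp: block_start_def min_def qr)
  ultimately show ?thesis using n by simp
qed

lemma block_start_unique:
  assumes "block_start n k c \<le> i" "i < block_start n k (Suc c)"
    and "block_start n k d \<le> i" "i < block_start n k (Suc d)"
  shows "c = d"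
proof (rule ccontr)
  assume "c \<noteq> d"
  then have "Suc c \<le> d \<or> Suc d \<le> c" by auto
  then show False
    using assms block_start_mono[of "Suc c" d n k] block_start_mono[of "Suc d" c n k] by auto
qed

lemma block_start_ex:
  assumes "k > 0" "i < n"
  obtains c where "c < k" "block_start n k c \<le> i" "i < block_start n k (Suc c)"
proof -
  \<comment> \<open>\<open>Suc c\<close> is the least index whose block starts beyond
    \<open>i\<close>.\<close>
  have "\<exists>c<k. (\<forall>d\<le>c. \<not> i < block_start n k d) \<and> i < block_start n k (Suc c)"
    by (rule ex_least_nat_less) (use assms in \<open>simp_all add: block_start_last\<close>)
  then show thesis using that by (metis le_refl not_less)
qed

text \<open>Enumerates first the first elements of all blocks, then the second elements, and so on, so
  that the successor inside a block is reached after \<open>k\<close> steps.\<close>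

definition across :: "nat \<Rightarrow> nat \<Rightarrow> nat \<Rightarrow> nat" where
  "across n k x = block_start n k (x mod k) + x div k"

lemma across_in_block:
  assumes "k > 0" "x < n"
  shows "across n k x < block_start n k (Suc (x mod k))"
  using assms block_start_inside_iff[of "x mod k" k n "x div k"] by (simp add: across_def)

lemma across_add: "k > 0 \<Longrightarrow> across n k (x + k) = Suc (across n k x)"
  by (simp add: across_def)

lemma across_less: "k > 0 \<Longrightarrow> x < n \<Longrightarrow> across n k x < n"
  using across_in_block[of k x n] block_start_mono[of "Suc (x mod k)" k n k]
  by (simp add: block_start_last Suc_leI)

text \<open>The block containing the image determines \<open>x mod k\<close>, and the offset in it
  is \<open>x div k\<close>.\<close>

lemma across_inj:
  assumes "k > 0"
  shows "inj_on (across n k) {..<n}"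
proof (rule inj_onI)
  fix x y assume *: "x \<in> {..<n}" "y \<in> {..<n}" "across n k x = across n k y"
  then have "across n k x < block_start n k (Suc (x mod k))"
    "across n k x < block_start n k (Suc (y mod k))"
    using *(1,2) across_in_block[OF assms, of x n] across_in_block[OF assms, of y n]
    unfolding *(3) by simp_all
  moreover have "block_start n k (x mod k) \<le> across n k x"
    "block_start n k (y mod k) \<le> across n k x"
    using *(3) by (simp_all add: across_def)
  ultimately have "x mod k = y mod k" using block_start_unique by blast
  moreover from this * have "x div k = y div k" by (simp add: across_def)
  ultimately show "x = y" by (metis div_mult_mod_eq)
qed

text \<open>Lists the tails of the deleted links, then a filler, then their heads. The filler \<open>0\<close>,
  the start of the first block, makes the distance between tail and head equal to \<open>k\<close>.\<close>

definition links :: "nat \<Rightarrow> nat \<Rightarrow> nat \<Rightarrow> nat" where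
  "links n k x = (if Suc x < k then block_start n k (Suc x) - 1
    else if Suc x = k then 0 else block_start n k (Suc x - k))"

lemma block_start_strict_mono:
  assumes "k > 0" "n \<ge> 2 * k" "c < d"
  shows "block_start n k c + 2 \<le> block_start n k d"
  using block_start_gap[OF assms(1,2), of c] block_start_mono[of "Suc c" d n k] assms(3) by simp

lemma block_start_inj:
  assumes "k > 0" "n \<ge> 2 * k"
  shows "block_start n k c = block_start n k d \<longleftrightarrow> c = d"
  using block_start_strict_mono[OF assms, of c d] block_start_strict_mono[OF assms, of d c]
  by (cases c d rule: linorder_cases) auto

text \<open>Keeps the tails of links apart from the heads; this rests on blocks having size at least
  2.\<close>

lemma block_start_not_consecutive:
  assumes "k > 0" "n \<ge> 2 * k"
  shows "block_start n k c \<noteq> Suc (block_start n k d)"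
  using block_start_strict_mono[OF assms, of c d] block_start_strict_mono[OF assms, of d c]
  by (cases c d rule: linorder_cases) auto

text \<open>Keeps tails and heads apart from the filler 0, and makes the truncated subtraction in a
  tail exact.\<close>

lemma block_start_Suc_ge:
  assumes "k > 0" "n \<ge> 2 * k"
  shows "block_start n k (Suc c) \<ge> 2"
  using block_start_strict_mono[OF assms, of 0 "Suc c"] by simp

lemma links_inj:
  assumes "k > 0" "n \<ge> 2 * k"
  shows "inj_on (links n k) {..<2 * k - 1}"
proof (rule linorder_inj_onI)
  fix x y assume xy: "x < y" "x \<in> {..<2 * k - 1}" "y \<in> {..<2 * k - 1}"
  note ge = block_start_Suc_ge[OF assms]
  \<comment> \<open>The cases are: two tails, tail and filler, tail and head, filler and head, two
    heads.\<close>
  consider "Suc y < k" | "Suc x < k" "Suc y = k" | "Suc x < k" "k < Suc y"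
    | "Suc x = k" "k < Suc y" | "k < Suc x" "k < Suc y" using xy by linarith
  then show "links n k x \<noteq> links n k y"
  proof cases
    case 1
    then show ?thesis
      using xy block_start_strict_mono[OF assms, of "Suc x" "Suc y"] ge[of x]
      by (simp add: links_def)
  next
    case 2
    then show ?thesis using ge[of x] by (simp add: links_def)
  next
    case 3
    then show ?thesis
      using block_start_not_consecutive[OF assms, of "Suc x" "Suc y - k"] ge[of x]
      by (auto simp: links_def)
  next
    case 4
    then show ?thesis using ge[of "y - k"] by (simp add: links_def Suc_diff_le)
  next
    case 5
    then show ?thesis using xy by (simp add: links_def block_start_inj[OF assms])
  qed
qed auto

lemma links_less:
  assumes "k > 0" "n \<ge> 2 * k" "x < 2 * k - 1"
  shows "links n k x < n"
proof -
  have "Suc x - k < k" using assms by linarith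
  then show ?thesis
    using assms block_start_strict_mono[OF assms(1,2), of "Suc x" k]
      block_start_strict_mono[OF assms(1,2), of "Suc x - k" k]
    by (auto simp: links_def block_start_last)
qed

lemma links_add:
  assumes "k > 0" "n \<ge> 2 * k" "x + k < 2 * k - 1"
  shows "links n k x = block_start n k (Suc x) - 1" "links n k (x + k) = block_start n k (Suc x)"
  using assms by (auto simp: links_def)

section \<open>Splitting the Jordan block\<close>

text \<open>A superdiagonal position either stays inside a block, where \<open>across\<close>
  provides it, or crosses into the next block, where \<open>links\<close> does.\<close>

lemma jordan_block_eq_chain_mats:
  assumes k: "k > 0" and n: "n \<ge> 2 * k"
  shows "jordan_block n (0 :: 'a :: field)
    = chain_mat n n (across n k) k + chain_mat n (2 * k - 1) (links n k) k"
proof (rule eq_matI)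
  fix i j
  let ?A = "\<exists>x. x + k < n \<and> i = across n k x \<and> j = across n k (x + k)"
  let ?B = "\<exists>x. x + k < 2 * k - 1 \<and> i = links n k x \<and> j = links n k (x + k)"
  assume "i < dim_row (chain_mat n n (across n k) k + chain_mat n (2 * k - 1) (links n k) k :: 'a mat)"
    "j < dim_col (chain_mat n n (across n k) k + chain_mat n (2 * k - 1) (links n k) k :: 'a mat)"
  then have ij: "i < n" "j < n" by (simp_all add: chain_mat_def)
  obtain c where c: "c < k" "block_start n k c \<le> i" "i < block_start n k (Suc c)"
    using block_start_ex[OF k ij(1)] .
  have A: "?A \<longleftrightarrow> j = Suc i \<and> j < block_start n k (Suc c)"
  proof
    assume ?A
    then obtain x where x: "x + k < n" "i = across n k x" "j = across n k (x + k)" by blast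
    have "x mod k = c"
      by (rule block_start_unique[of n k _ i])
        (use x c k in \<open>auto simp: across_in_block, auto simp: across_def\<close>)
    then show "j = Suc i \<and> j < block_start n k (Suc c)"
      using x k across_in_block[of k "x + k" n] by (simp add: across_add)
  next
    assume j: "j = Suc i \<and> j < block_start n k (Suc c)"
    \<comment> \<open>The number of \<open>i\<close> in the enumeration \<open>across\<close>:
      offset times \<open>k\<close> plus block index.\<close>
    define x where "x = (i - block_start n k c) * k + c"
    have "x + k = Suc (i - block_start n k c) * k + c" by (simp add: x_def)
    also have "\<dots> < n"
      using j c block_start_inside_iff[of c k n "Suc (i - block_start n k c)"] by simp
    finally have "x + k < n" .
    moreover have "i = across n k x" using c by (simp add: x_def across_def)
    ultimately show ?A using j k by (intro exI[of _ x]) (simp add: across_add)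
  qed
  have B: "?B \<longleftrightarrow> j = Suc i \<and> j = block_start n k (Suc c)"
  proof
    assume ?B
    then obtain x where x: "x + k < 2 * k - 1" "i = links n k x" "j = links n k (x + k)" by blast
    then have i: "i = block_start n k (Suc x) - 1" and j: "j = block_start n k (Suc x)"
      using links_add[OF k n x(1)] by simp_all
    have "x = c"
      by (rule block_start_unique[of n k _ i])
        (use c i block_start_gap[OF k n, of x] in auto)
    with i j show "j = Suc i \<and> j = block_start n k (Suc c)"
      using block_start_Suc_ge[OF k n, of x] by simp
  next
    assume j: "j = Suc i \<and> j = block_start n k (Suc c)"
    \<comment> \<open>The last block has no outgoing link, since the next start would be
      \<open>n\<close>.\<close>
    then have "Suc c \<noteq> k" using ij(2) k by (auto simp: block_start_last)
    then have "c + k < 2 * k - 1" using c(1) by simp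
    then show ?B using j links_add[OF k n, of c] by (intro exI[of _ c]) auto
  qed
  have "(chain_mat n n (across n k) k + chain_mat n (2 * k - 1) (links n k) k :: 'a mat) $$ (i, j)
    = (if ?A then 1 else 0) + (if ?B then 1 else 0)"
    using ij by (simp add: chain_mat_def)
  also have "\<dots> = (if j = Suc i then 1 else 0)"
    \<comment> \<open>As \<open>i\<close> lies in block \<open>c\<close>, \<open>Suc i\<close> is at
      most the next start, so exactly one of the two conditions holds when
      \<open>j = Suc i\<close>.\<close>
    unfolding A B using c(3) by auto
  also have "\<dots> = jordan_block n (0 :: 'a) $$ (i, j)"
    using ij by (auto simp: jordan_block_def)
  finally show "jordan_block n (0 :: 'a) $$ (i, j)
    = (chain_mat n n (across n k) k + chain_mat n (2 * k - 1) (links n k) k) $$ (i, j)" ..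
qed (simp_all add: chain_mat_def)

theorem theorem1p2:
  fixes k n :: nat
  assumes "k \<ge> 2"
    and "n \<ge> 2 * k"
  shows "\<exists>A \<in> carrier_mat n n. \<exists>B \<in> carrier_mat n n.
    jordan_block n (0 :: 'a :: field) = A ^\<^sub>m k + B ^\<^sub>m k"
proof (intro bexI)
  have k: "k > 0" "k \<ge> 1" using assms(1) by simp_all
  have "chain_mat n n (across n k) 1 ^\<^sub>m k = (chain_mat n n (across n k) k :: 'a mat)"
    by (rule chain_mat_pow) (use k in \<open>auto simp: across_inj across_less\<close>)
  moreover have "chain_mat n (2 * k - 1) (links n k) 1 ^\<^sub>m k
      = (chain_mat n (2 * k - 1) (links n k) k :: 'a mat)"
    by (rule chain_mat_pow) (use k assms(2) links_inj[of k n] in \<open>auto simp: links_less\<close>)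
  ultimately show "jordan_block n (0 :: 'a)
      = chain_mat n n (across n k) 1 ^\<^sub>m k + chain_mat n (2 * k - 1) (links n k) 1 ^\<^sub>m k"
    using jordan_block_eq_chain_mats[OF k(1) assms(2)] by simp
qed simp_all

end
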